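(* Let $C\in\mathcal C$ be an arbitrary elasticity tensor. Among all isotropic elasticity tensors, the one closest to $C$ in the Euclidean (Frobenius) norm is $${}^{\rm (iso)}C_{ijkl}=\tfrac1{15}S(\delta_{ij}\delta_{kl}+\delta_{ik}\delta_{jl}+\delta_{il}\delta_{jk})+\tfrac16A(2\delta_{ij}\delta_{kl}-\delta_{il}\delta_{jk}-\delta_{ik}\delta_{jl}),$$ where $S=\frac13(C_{iikk}+2C_{ikik})$ and $A=\frac13(C_{iikk}-C_{ikik})$. Equivalently, ${}^{\rm (iso)}C_{ijkl}=\lambda\,\delta_{ij}\delta_{kl}+\mu(\delta_{ik}\delta_{jl}+\delta_{il}\delta_{jk})$ with effective Lamé moduli $$\lambda=\tfrac1{15}S+\tfrac13A=\tfrac2{15}C_{iijj}-\tfrac1{15}C_{ijij},\qquad \mu=\tfrac1{15}S-\tfrac16A=\tfrac1{10}C_{ijij}-\tfrac1{30}C_{iijj},$$ and the corresponding bulk modulus $\kappa=\lambda+\frac23\mu$ is $\kappa=\frac19C_{iijj}$.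
   Context: Indices run over $1,2,3$, rectangular (orthonormal) coordinates on Euclidean $\mathbb R^3$ are used, so the metric is $\delta_{ij}$; repeated indices are summed. The space $\mathcal C$ of elasticity tensors consists of all real arrays $C_{ijkl}$ with $C_{ijkl}=C_{jikl}=C_{klij}$ (hence also $C_{ijkl}=C_{ijlk}$). The Euclidean (Frobenius) norm is $\|C\|=\sqrt{C_{ijkl}C_{ijkl}}$. An isotropic elasticity tensor is one of the form $\lambda'\delta_{ij}\delta_{kl}+\mu'(\delta_{ik}\delta_{jl}+\delta_{il}\delta_{jk})$ with $\lambda',\mu'\in\mathbb R$ (equivalently, an $SO(3)$-invariant element of $\mathcal C$). *)

theory Defs
  imports "HOL-Analysis.Analysis"
begin

text \<open>
  A fourth-order tensor over Euclidean 3-space is the array of its components in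
  rectangular coordinates, so that \<open>C $ i $ j $ k $ l\<close> is the component with indices
  \<open>i, j, k, l\<close>.
\<close>

type_synonym tensor4 = "real ^ 3 ^ 3 ^ 3 ^ 3"

definition elasticity_tensors :: "tensor4 set" where
  "elasticity_tensors =
    {C. \<forall>i j k l. C $ i $ j $ k $ l = C $ j $ i $ k $ l \<and> C $ i $ j $ k $ l = C $ k $ l $ i $ j}"

definition delta :: "3 \<Rightarrow> 3 \<Rightarrow> real" where
  "delta i j = (if i = j then 1 else 0)"

definition lame_tensor :: "real \<Rightarrow> real \<Rightarrow> tensor4" where
  "lame_tensor lam mu =
    (\<chi> i j k l. lam * (delta i j * delta k l) + mu * (delta i k * delta j l + delta i l * delta j k))"

definition isotropic_elasticity_tensors :: "tensor4 set" where
  "isotropic_elasticity_tensors = {D. \<exists>lam mu. D = lame_tensor lam mu}"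

definition contr_iikk :: "tensor4 \<Rightarrow> real" where
  "contr_iikk C = (\<Sum>i\<in>UNIV. \<Sum>k\<in>UNIV. C $ i $ i $ k $ k)"

definition contr_ikik :: "tensor4 \<Rightarrow> real" where
  "contr_ikik C = (\<Sum>i\<in>UNIV. \<Sum>k\<in>UNIV. C $ i $ k $ i $ k)"

text \<open>The library norm on the iterated vector type is the Frobenius norm of the array.\<close>

lemma norm_tensor4:
  fixes C :: tensor4
  shows "norm C = sqrt (\<Sum>i\<in>UNIV. \<Sum>j\<in>UNIV. \<Sum>k\<in>UNIV. \<Sum>l\<in>UNIV.
                    C $ i $ j $ k $ l * C $ i $ j $ k $ l)"
  by (simp add: norm_eq_sqrt_inner inner_vec_def)

lemma isotropic_subset_elasticity:
  "isotropic_elasticity_tensors \<subseteq> elasticity_tensors"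
  by (auto simp: isotropic_elasticity_tensors_def elasticity_tensors_def lame_tensor_def delta_def)

end

(* The isotropic tensors form a linear subspace, so the unique closest one is the orthogonal
   projection. Pairing C with a Lame tensor only sees the two traces C_iikk and C_ikik, hence the
   projection is the Lame tensor having the same two traces as C. *)

theory Submission
  imports Defs
begin

text \<open>For \<open>v\<close> in \<open>V\<close> the vector \<open>p - v\<close> lies in
  \<open>V\<close>, hence is orthogonal to \<open>x - p\<close>. By Pythagoras, replacing
  \<open>p\<close> by \<open>v\<close> raises the squared distance to \<open>x\<close> by exactly
  the squared norm of \<open>p - v\<close>.\<close>

lemma is_arg_min_norm_diff_subspace_iff:
  fixes x p y :: "'a::real_inner"
  assumes V: "subspace V" and p: "p \<in> V" and orth: "\<And>v. v \<in> V \<Longrightarrow> orthogonal (x - p) v"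
  shows "is_arg_min (\<lambda>v. norm (x - v)) (\<lambda>v. v \<in> V) y \<longleftrightarrow> y = p"
proof -
  have pyth: "(norm (x - v))\<^sup>2 = (norm (x - p))\<^sup>2 + (norm (p - v))\<^sup>2" if "v \<in> V" for v
  proof -
    have "orthogonal (x - p) (p - v)"
      using that V p by (intro orth subspace_diff)
    then show ?thesis
      using norm_add_Pythagorean[of "x - p" "p - v"] by simp
  qed
  \<comment> \<open>Strictness gives both directions: no \<open>v\<close> beats \<open>p\<close>,
    and \<open>p\<close> beats every other candidate.\<close>
  have lt: "norm (x - p) < norm (x - v)" if "v \<in> V" "v \<noteq> p" for v
    by (rule power2_less_imp_less) (use pyth[of v] that in auto)
  show ?thesis
    using p lt unfolding is_arg_min_def by (metis less_asym')
qed

lemma subspace_isotropic_elasticity_tensors: "subspace isotropic_elasticity_tensors"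
proof (rule subspaceI)
  have "0 = lame_tensor 0 0"
    by (simp add: lame_tensor_def vec_eq_iff)
  then show "0 \<in> isotropic_elasticity_tensors"
    unfolding isotropic_elasticity_tensors_def by blast
next
  fix D E assume "D \<in> isotropic_elasticity_tensors" "E \<in> isotropic_elasticity_tensors"
  then obtain a b c d where "D = lame_tensor a b" "E = lame_tensor c d"
    by (auto simp: isotropic_elasticity_tensors_def)
  then have "D + E = lame_tensor (a + c) (b + d)"
    by (simp add: lame_tensor_def vec_eq_iff algebra_simps)
  then show "D + E \<in> isotropic_elasticity_tensors"
    unfolding isotropic_elasticity_tensors_def by blast
next
  fix r D assume "D \<in> isotropic_elasticity_tensors"
  then obtain a b where "D = lame_tensor a b"
    by (auto simp: isotropic_elasticity_tensors_def)
  then have "r *\<^sub>R D = lame_tensor (r * a) (r * b)"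
    by (simp add: lame_tensor_def vec_eq_iff algebra_simps)
  then show "r *\<^sub>R D \<in> isotropic_elasticity_tensors"
    unfolding isotropic_elasticity_tensors_def by blast
qed

lemma contr_iikk_lame_tensor: "contr_iikk (lame_tensor a b) = 9 * a + 6 * b"
  by (simp add: contr_iikk_def lame_tensor_def delta_def sum_3)

lemma contr_ikik_lame_tensor: "contr_ikik (lame_tensor a b) = 3 * a + 12 * b"
  by (simp add: contr_ikik_def lame_tensor_def delta_def sum_3)

text \<open>The three delta products contract \<open>C\<close> to \<open>C_iikk\<close>,
  \<open>C_ikik\<close> and \<open>C_ijji\<close>. The last two agree because of the symmetry in the
  first index pair, whence the factor 2.\<close>

lemma inner_lame_tensor:
  assumes "C \<in> elasticity_tensors"
  shows "C \<bullet> lame_tensor a b = a * contr_iikk C + 2 * b * contr_ikik C"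
proof -
  have sym: "C $ i $ j $ j $ i = C $ j $ i $ j $ i" for i j
    using assms by (simp add: elasticity_tensors_def)
  have "C \<bullet> lame_tensor a b =
      a * contr_iikk C + b * (contr_ikik C + (\<Sum>i\<in>UNIV. \<Sum>j\<in>UNIV. C $ i $ j $ j $ i))"
    by (simp add: inner_vec_def lame_tensor_def contr_iikk_def contr_ikik_def delta_def sum_3
        algebra_simps)
  also have "(\<Sum>i\<in>UNIV. \<Sum>j\<in>UNIV. C $ i $ j $ j $ i) = (\<Sum>i\<in>UNIV. \<Sum>j\<in>UNIV. C $ j $ i $ j $ i)"
    by (intro sum.cong refl sym)
  \<comment> \<open>Only the names of the two summation indices differ.\<close>
  also have "\<dots> = contr_ikik C"
    unfolding contr_ikik_def by (rule sum.swap)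
  finally show ?thesis
    by (simp add: algebra_simps)
qed

theorem mainTheorem3:
  fixes C isoC :: tensor4 and S A lam mu kappa :: real
  assumes "C \<in> elasticity_tensors"
    and "S = 1 / 3 * (contr_iikk C + 2 * contr_ikik C)"
    and "A = 1 / 3 * (contr_iikk C - contr_ikik C)"
    and "isoC = (\<chi> i j k l.
           1 / 15 * S * (delta i j * delta k l + delta i k * delta j l + delta i l * delta j k)
         + 1 / 6 * A * (2 * (delta i j * delta k l) - delta i l * delta j k - delta i k * delta j l))"
    and "lam = 1 / 15 * S + 1 / 3 * A"
    and "mu = 1 / 15 * S - 1 / 6 * A"
    and "kappa = lam + 2 / 3 * mu"
  shows "(\<forall>D. is_arg_min (\<lambda>E. norm (C - E)) (\<lambda>E. E \<in> isotropic_elasticity_tensors) D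
               \<longleftrightarrow> D = isoC)
    \<and> isoC = lame_tensor lam mu
    \<and> lam = 2 / 15 * contr_iikk C - 1 / 15 * contr_ikik C
    \<and> mu = 1 / 10 * contr_ikik C - 1 / 30 * contr_iikk C
    \<and> kappa = 1 / 9 * contr_iikk C"
proof (intro conjI)
  show lam: "lam = 2 / 15 * contr_iikk C - 1 / 15 * contr_ikik C"
    using assms by (simp add: field_simps)
  show mu: "mu = 1 / 10 * contr_ikik C - 1 / 30 * contr_iikk C"
    using assms by (simp add: field_simps)
  \<comment> \<open>The \<open>C_ikik\<close> terms cancel, since 2/3 * 1/10 = 1/15.\<close>
  show "kappa = 1 / 9 * contr_iikk C"
    using lam mu \<open>kappa = lam + 2 / 3 * mu\<close> by (simp add: field_simps)
  \<comment> \<open>Compare coefficients: \<open>delta i j * delta k l\<close> carries S/15 + 2A/6,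
    each of the other two products S/15 - A/6.\<close>
  show isoC: "isoC = lame_tensor lam mu"
    unfolding assms(4-6) lame_tensor_def vec_eq_iff by (simp add: algebra_simps)
  show "\<forall>D. is_arg_min (\<lambda>E. norm (C - E)) (\<lambda>E. E \<in> isotropic_elasticity_tensors) D
               \<longleftrightarrow> D = isoC"
  proof (intro allI is_arg_min_norm_diff_subspace_iff subspace_isotropic_elasticity_tensors)
    show iso: "isoC \<in> isotropic_elasticity_tensors"
      unfolding isotropic_elasticity_tensors_def isoC by blast
    fix E assume "E \<in> isotropic_elasticity_tensors"
    then obtain a b where E: "E = lame_tensor a b"
      by (auto simp: isotropic_elasticity_tensors_def)
    \<comment> \<open>The moduli are the unique solution of 9 \<open>lam\<close> + 6
      \<open>mu\<close> = \<open>C_iikk\<close>, 3 \<open>lam\<close> + 12 \<open>mu\<close> =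
      \<open>C_ikik\<close>, a system with determinant 90.\<close>
    have traces: "contr_iikk isoC = contr_iikk C" "contr_ikik isoC = contr_ikik C"
      unfolding isoC contr_iikk_lame_tensor contr_ikik_lame_tensor by (simp_all add: lam mu)
    \<comment> \<open>With this, \<open>inner_lame_tensor\<close> applies to \<open>isoC\<close> as
      well as to \<open>C\<close>; equal traces then give equal inner products with
      \<open>E\<close>.\<close>
    have "isoC \<in> elasticity_tensors"
      using iso isotropic_subset_elasticity by blast
    then have "C \<bullet> E = isoC \<bullet> E"
      unfolding E using \<open>C \<in> elasticity_tensors\<close> by (simp add: inner_lame_tensor traces)
    then show "orthogonal (C - isoC) E"
      by (simp add: orthogonal_def inner_diff_left)
  qed
qed

end
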